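(* For all compositions $\alpha,\beta$ of $n$ and $N\ge n$, the coefficient of $G_\beta(x_1,\ldots,x_N;t)$ in the expansion of $M_\alpha(x_1,\ldots,x_N)$ in the basis $\{G_\gamma\}_\gamma$ equals $(-1)^{\ell(\beta)-\ell(\alpha)}\prod_{j:\ \xi_{\alpha,\beta}(j)=j}(1-t^j)$ if $\beta\succeq\alpha$, and $0$ otherwise.
   Context: For a composition $\alpha=(\alpha_1,\ldots,\alpha_k)$ of $n$, $\ell(\alpha)=k$ and $\mathrm{sub}(\alpha)=\{\alpha_1,\alpha_1+\alpha_2,\ldots,\alpha_1+\cdots+\alpha_{k-1}\}$. $\beta\succeq\alpha$ iff $\mathrm{sub}(\alpha)\subseteq\mathrm{sub}(\beta)$. If $\beta\succeq\alpha$ with $\ell(\beta)=m$, write $\alpha_j=\beta_{i_{j-1}+1}+\dots+\beta_{i_j}$ with $0=i_0<\dots<i_k=m$, and $s(\alpha,\beta)=\sum_{j=1}^k j(i_j-i_{j-1}-1)$. For $1\le j\le\ell(\beta)-1$, $\xi_{\alpha,\beta}(j)=j$ if $\beta_j,\beta_{j+1}$ are formed from the same part of $\alpha$ (i.e. $\beta_1+\dots+\beta_j\notin\mathrm{sub}(\alpha)$) and $0$ otherwise. $M_\alpha(x_1,\ldots,x_N)=\sum_{1\le i_1<\dots<i_k\le N}x_{i_1}^{\alpha_1}\cdots x_{i_k}^{\alpha_k}$ is the monomial quasisymmetric polynomial. $F_\alpha(x_1,\ldots,x_N)=\sum x_{w_1}\cdots x_{w_n}$ over $1\le w_1\le\dots\le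 w_n\le N$ with $w_j<w_{j+1}$ for $j\in\mathrm{sub}(\alpha)$. Hivert's quasisymmetric Hall–Littlewood polynomials satisfy (and may be taken to be defined by) $G_\alpha(x_1,\ldots,x_N;t)=\sum_{\beta\succeq\alpha}(-1)^{\ell(\beta)-\ell(\alpha)}t^{s(\alpha,\beta)}F_\beta$; for $N\ge n$ they form a basis of the degree-$n$ quasisymmetric polynomials over $\mathbb{Q}(t)$. *)

theory Defs
  imports
    "HOL-Library.Poly_Mapping"
    "HOL-Computational_Algebra.Polynomial"
    "HOL-Computational_Algebra.Fraction_Field"
begin

definition compositions :: "nat \<Rightarrow> nat list set" where
  "compositions n = {\<alpha>. sum_list \<alpha> = n \<and> (\<forall>a\<in>set \<alpha>. 0 < a)}"

definition sub :: "nat list \<Rightarrow> nat set" where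
  "sub \<alpha> = {sum_list (take i \<alpha>) | i. 1 \<le> i \<and> i < length \<alpha>}"

text \<open>\<open>refines \<beta> \<alpha>\<close> is \<open>\<beta> \<succeq> \<alpha>\<close> for compositions of the same number.\<close>

definition refines :: "nat list \<Rightarrow> nat list \<Rightarrow> bool" where
  "refines \<beta> \<alpha> \<longleftrightarrow> sub \<alpha> \<subseteq> sub \<beta>"

text \<open>Parts of a composition are numbered from 1 in the mathematics, so the \<open>j\<close>-th part of
  \<open>\<alpha>\<close> is \<open>\<alpha> ! (j - 1)\<close>. For compositions \<open>\<alpha>\<close> and \<open>\<beta>\<close> with \<open>refines \<beta> \<alpha>\<close> the breaks
  \<open>i\<^sub>0, \<dots>, i\<^sub>k\<close> exist and are unique; the values \<open>i\<^sub>j\<close> with \<open>j > length \<alpha>\<close> are irrelevant.\<close>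

definition is_breaks :: "nat list \<Rightarrow> nat list \<Rightarrow> (nat \<Rightarrow> nat) \<Rightarrow> bool" where
  "is_breaks \<alpha> \<beta> i \<longleftrightarrow> i 0 = 0 \<and> i (length \<alpha>) = length \<beta> \<and>
    (\<forall>j\<in>{1..length \<alpha>}. i (j - 1) < i j \<and>
       \<alpha> ! (j - 1) = (\<Sum>p = i (j - 1) + 1..i j. \<beta> ! (p - 1)))"

definition breaks :: "nat list \<Rightarrow> nat list \<Rightarrow> nat \<Rightarrow> nat" where
  "breaks \<alpha> \<beta> = (SOME i. is_breaks \<alpha> \<beta> i)"

definition s_stat :: "nat list \<Rightarrow> nat list \<Rightarrow> nat" where
  "s_stat \<alpha> \<beta> = (\<Sum>j = 1..length \<alpha>. j * (breaks \<alpha> \<beta> j - breaks \<alpha> \<beta> (j - 1) - 1))"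

definition xi :: "nat list \<Rightarrow> nat list \<Rightarrow> nat \<Rightarrow> nat" where
  "xi \<alpha> \<beta> j = (if sum_list (take j \<beta>) \<notin> sub \<alpha> then j else 0)"

text \<open>Polynomials in commuting variables \<open>x\<^sub>0, x\<^sub>1, \<dots>\<close>: an exponent vector is a finitely supported
  function \<open>nat \<Rightarrow>\<^sub>0 nat\<close>, and multiplication is convolution. The polynomials below, in \<open>N\<close>
  variables, involve only \<open>x\<^sub>1, \<dots>, x\<^sub>N\<close>.\<close>

type_synonym 'a mpoly = "(nat \<Rightarrow>\<^sub>0 nat) \<Rightarrow>\<^sub>0 'a"

definition X :: "nat \<Rightarrow> 'a::comm_ring_1 mpoly" where
  "X i = Poly_Mapping.single (Poly_Mapping.single i 1) 1"

definition cmul :: "'a::comm_ring_1 \<Rightarrow> 'a mpoly \<Rightarrow> 'a mpoly" where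
  "cmul c p = Poly_Mapping.single 0 c * p"

interpretation mpoly: vector_space "cmul :: 'a::field \<Rightarrow> 'a mpoly \<Rightarrow> 'a mpoly"
  by unfold_locales
    (simp_all add: cmul_def algebra_simps single_add mult_single flip: mult.assoc)

definition M :: "nat \<Rightarrow> nat list \<Rightarrow> 'a::comm_ring_1 mpoly" where
  "M N \<alpha> = (\<Sum>i\<in>{i. length i = length \<alpha> \<and> set i \<subseteq> {1..N} \<and> sorted_wrt (<) i}.
     \<Prod>j<length \<alpha>. X (i ! j) ^ (\<alpha> ! j))"

definition F :: "nat \<Rightarrow> nat list \<Rightarrow> 'a::comm_ring_1 mpoly" where
  "F N \<alpha> = (\<Sum>w\<in>{w. length w = sum_list \<alpha> \<and> set w \<subseteq> {1..N} \<and> sorted_wrt (\<le>) w \<and>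
                    (\<forall>j\<in>sub \<alpha>. w ! (j - 1) < w ! j)}.
     \<Prod>j<sum_list \<alpha>. X (w ! j))"

definition G :: "nat \<Rightarrow> 'a::comm_ring_1 \<Rightarrow> nat list \<Rightarrow> 'a mpoly" where
  "G N t \<alpha> = (\<Sum>\<beta>\<in>{\<beta> \<in> compositions (sum_list \<alpha>). refines \<beta> \<alpha>}.
     cmul ((- 1) ^ (length \<beta> - length \<alpha>) * t ^ s_stat \<alpha> \<beta>) (F N \<beta>))"

text \<open>The indeterminate of the field of rational functions over the rationals.\<close>

definition tt :: "rat poly fract" where
  "tt = Fract [:0, 1:] 1"

text \<open>The coefficient of \<open>G N tt \<beta>\<close> in the expansion of \<open>f\<close> in the basis of all \<open>G N tt \<gamma>\<close>.
  The library's \<open>representation\<close> is zero unless its first argument is linearly independent and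
  \<open>f\<close> lies in its span. It is indexed by basis vectors, so \<open>G_coeff\<close> has its intended meaning
  when \<open>G N tt\<close> is injective on \<open>compositions n\<close>, which is the case for \<open>n \<le> N\<close>.\<close>

definition G_coeff :: "nat \<Rightarrow> nat \<Rightarrow> rat poly fract mpoly \<Rightarrow> nat list \<Rightarrow> rat poly fract" where
  "G_coeff n N f \<beta> = mpoly.representation (G N tt ` compositions n) f (G N tt \<beta>)"

end

(* Compositions of n correspond to subsets of {1..<n} via sub. With A = sub alpha, C = sub gamma,
   the expansions of M_alpha in the F_gamma (inclusion-exclusion over the rises of weakly increasing
   words) and of G_beta in the F_gamma reduce the claim to the identity
     sum over A <= B <= C of (prod_{b in B - A} (1 - t^{w_B b})) * (prod_{c in C - B} t^{w_B c}) = 1,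
   where w_B c = 1 + #{b in B. b < c} is the index of the part of beta containing c. *)

theory Submission
  imports Defs
begin

subsection \<open>Compositions as sets of partial sums\<close>

text \<open>The statistics s and xi become comparable because both assign numbers to the partial
  sums that \<beta> has and \<alpha> lacks. For s, every new partial sum inside the j-th part of
  \<alpha> counts j, since splitting that part into i_j - i_{j-1} pieces creates one new sum fewer
  than pieces. For xi, the j-th partial sum of \<beta> counts j. One plus the number of strictly
  smaller elements of the coarser, respectively finer, set gives both values, so all exponents
  depend on subsets of {1..<n} alone. An expansion of M in the G does not yet determine a
  coefficient: the G must be independent, and pairwise distinct because
  \<open>representation\<close> is indexed by vectors. Both follow from the expansion itself by
  counting, once the M are known to be independent. For the M this is read off from monomials, and
  it needs at least one word for every rise set; this is the source of the condition
  \<open>n \<le> N\<close>.\<close>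

abbreviation psum :: "nat list \<Rightarrow> nat \<Rightarrow> nat" where
  "psum \<alpha> j \<equiv> sum_list (take j \<alpha>)"

lemma psum_Suc: "j < length \<alpha> \<Longrightarrow> psum \<alpha> (Suc j) = psum \<alpha> j + \<alpha> ! j"
  by (simp add: take_Suc_conv_app_nth)

lemma psum_strict_mono:
  assumes "\<alpha> \<in> compositions n" "i < j" "j \<le> length \<alpha>"
  shows "psum \<alpha> i < psum \<alpha> j"
  using assms(2,3)
proof (induction j)
  case (Suc j)
  have "0 < \<alpha> ! j" using assms(1) Suc.prems by (simp add: compositions_def)
  moreover have "psum \<alpha> i \<le> psum \<alpha> j"
    using Suc by (cases "i = j") auto
  ultimately show ?case using Suc.prems by (simp add: psum_Suc)
qed simp

lemma psum_less_iff:
  assumes "\<alpha> \<in> compositions n" "i \<le> length \<alpha>" "j \<le> length \<alpha>"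
  shows "psum \<alpha> i < psum \<alpha> j \<longleftrightarrow> i < j"
  using psum_strict_mono[OF assms(1), of i j] psum_strict_mono[OF assms(1), of j i] assms
  by (cases i j rule: linorder_cases) auto

lemma psum_eq_iff:
  assumes "\<alpha> \<in> compositions n" "i \<le> length \<alpha>" "j \<le> length \<alpha>"
  shows "psum \<alpha> i = psum \<alpha> j \<longleftrightarrow> i = j"
  using psum_less_iff[OF assms] psum_less_iff[OF assms(1,3,2)]
  by (cases i j rule: linorder_cases) auto

lemma psum_le_iff:
  assumes "\<alpha> \<in> compositions n" "i \<le> length \<alpha>" "j \<le> length \<alpha>"
  shows "psum \<alpha> i \<le> psum \<alpha> j \<longleftrightarrow> i \<le> j"
  using psum_less_iff[OF assms(1,3,2)] by (simp add: not_less[symmetric])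

lemma psum_length: "\<alpha> \<in> compositions n \<Longrightarrow> psum \<alpha> (length \<alpha>) = n"
  by (simp add: compositions_def)

lemma sub_eq_image: "sub \<alpha> = psum \<alpha> ` {1..<length \<alpha>}"
  by (auto simp: sub_def)

lemma finite_sub [simp]: "finite (sub \<alpha>)"
  by (simp add: sub_eq_image)

lemma inj_on_psum: "\<alpha> \<in> compositions n \<Longrightarrow> inj_on (psum \<alpha>) {..length \<alpha>}"
  by (auto simp: inj_on_def psum_eq_iff)

lemma sub_subset:
  assumes "\<alpha> \<in> compositions n"
  shows "sub \<alpha> \<subseteq> {1..<n}"
  using psum_strict_mono[OF assms, of 0] psum_strict_mono[OF assms, of _ "length \<alpha>"]
    psum_length[OF assms]
  by (fastforce simp: sub_eq_image Suc_le_eq)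

lemma card_sub:
  assumes "\<alpha> \<in> compositions n"
  shows "card (sub \<alpha>) = length \<alpha> - 1"
proof -
  have "inj_on (psum \<alpha>) {1..<length \<alpha>}"
    by (rule inj_on_subset[OF inj_on_psum[OF assms]]) auto
  then show ?thesis by (simp add: sub_eq_image card_image)
qed

lemma psum_in_sub_iff:
  assumes "\<alpha> \<in> compositions n" "j < length \<alpha>"
  shows "psum \<alpha> j \<in> sub \<alpha> \<longleftrightarrow> 0 < j"
  using assms by (auto simp: sub_eq_image psum_eq_iff Suc_le_eq)

lemma length_diff_eq_card:
  assumes "\<alpha> \<in> compositions n" "\<beta> \<in> compositions n" "refines \<beta> \<alpha>"
  shows "length \<beta> - length \<alpha> = card (sub \<beta> - sub \<alpha>)"
proof (cases "n = 0")
  case True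
  have "\<gamma> = []" if "\<gamma> \<in> compositions n" for \<gamma>
    using that True by (cases \<gamma>) (auto simp: compositions_def)
  then have "\<alpha> = []" "\<beta> = []" using assms(1,2) by blast+
  then show ?thesis by (simp add: sub_def)
next
  case False
  \<comment> \<open>For n > 0 the lengths are positive, so the truncated subtraction in
    \<open>card_sub\<close> is exact.\<close>
  have "\<gamma> \<noteq> []" if "\<gamma> \<in> compositions n" for \<gamma>
    using that False by (cases \<gamma>) (auto simp: compositions_def)
  then have "\<alpha> \<noteq> []" "\<beta> \<noteq> []" using assms(1,2) by blast+
  then have "0 < length \<alpha>" "0 < length \<beta>" by auto
  moreover have "card (sub \<beta> - sub \<alpha>) = card (sub \<beta>) - card (sub \<alpha>)"
    using assms(3) by (simp add: card_Diff_subset refines_def)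
  ultimately show ?thesis using card_sub[OF assms(1)] card_sub[OF assms(2)] by linarith
qed

text \<open>Appending a part adds a new largest partial sum. Injectivity and surjectivity of
  \<open>sub\<close> are therefore both proved by peeling off the last part.\<close>

lemma sub_snoc: "sub (xs @ [a]) = (if xs = [] then {} else insert (sum_list xs) (sub xs))"
proof (cases "xs = []")
  case True
  then show ?thesis by (auto simp: sub_def)
next
  case False
  then have "{1..<length (xs @ [a])} = insert (length xs) {1..<length xs}"
    by (cases xs) auto
  then show ?thesis using False by (auto simp: sub_eq_image)
qed

lemma inj_on_sub: "inj_on sub (compositions n)"
proof -
  have "\<alpha> = \<beta>" if "\<alpha> \<in> compositions n" "\<beta> \<in> compositions n" "sub \<alpha> = sub \<beta>" for \<alpha> \<beta>
    using that
  proof (induction \<alpha> arbitrary: \<beta> n rule: rev_induct)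
    case Nil
    then show ?case by (cases \<beta>) (auto simp: compositions_def)
  next
    case (snoc a xs)
    have "\<beta> \<noteq> []" using snoc.prems by (auto simp: compositions_def)
    then obtain ys b where \<beta>: "\<beta> = ys @ [b]" by (metis rev_exhaust)
    have xs: "xs \<in> compositions (sum_list xs)" and ys: "ys \<in> compositions (sum_list ys)"
      using snoc.prems by (auto simp: \<beta> compositions_def)
    \<comment> \<open>The sum of all parts but the last is the largest element of the set and hence
      determined by it; the last part then follows from the total n.\<close>
    have Max: "Max (insert (sum_list zs) (sub zs)) = sum_list zs" "sum_list zs \<notin> sub zs"
      if "zs \<in> compositions (sum_list zs)" for zs
      using sub_subset[OF that] by (auto intro!: Max_eqI)
    show ?case
    proof (cases "xs = []")
      case True
      then have "ys = []"
        using snoc.prems(3) by (auto simp: \<beta> sub_snoc simp del: append_Nil split: if_splits)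
      then show ?thesis using True snoc.prems by (simp add: \<beta> compositions_def)
    next
      case False
      then have "ys \<noteq> []"
        using snoc.prems(3) by (auto simp: \<beta> sub_snoc simp del: append_Nil split: if_splits)
      with False have eq: "insert (sum_list xs) (sub xs) = insert (sum_list ys) (sub ys)"
        using snoc.prems(3) by (simp add: \<beta> sub_snoc)
      then have sum: "sum_list xs = sum_list ys" using Max(1)[OF xs] Max(1)[OF ys] by simp
      then have "sub xs = sub ys" using eq Max(2)[OF xs] Max(2)[OF ys] by (metis insert_ident)
      then have "xs = ys" using snoc.IH[OF xs] ys sum by simp
      then show ?thesis using snoc.prems by (simp add: \<beta> compositions_def)
    qed
  qed
  then show ?thesis by (auto simp: inj_on_def)
qed

lemma sub_surj: "B \<subseteq> {1..<n} \<Longrightarrow> \<exists>\<alpha>\<in>compositions n. sub \<alpha> = B"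
proof (induction n arbitrary: B rule: less_induct)
  case (less n)
  have fin: "finite B" using less.prems finite_subset by blast
  show ?case
  proof (cases "B = {}")
    case True
    have "(if n = 0 then [] else [n]) \<in> compositions n" "sub (if n = 0 then [] else [n]) = {}"
      by (auto simp: compositions_def sub_def)
    then show ?thesis using True by blast
  next
    case False
    \<comment> \<open>The largest element has to be the sum of all parts but the last, which leaves
      \<open>n - m\<close> as the last part.\<close>
    define m where "m = Max B"
    have m: "m \<in> B" using False fin by (simp add: m_def)
    then have mn: "1 \<le> m" "m < n" using less.prems by auto
    have "B - {m} \<subseteq> {1..<m}"
      using less.prems Max_ge[OF fin] by (fastforce simp: m_def[symmetric])
    then obtain xs where xs: "xs \<in> compositions m" "sub xs = B - {m}" using less.IH mn by blast
    then have "xs \<noteq> []" using mn by (auto simp: compositions_def)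
    then have "xs @ [n - m] \<in> compositions n" "sub (xs @ [n - m]) = B"
      using xs mn m by (auto simp: compositions_def sub_snoc)
    then show ?thesis by blast
  qed
qed

lemma bij_betw_sub: "bij_betw sub (compositions n) (Pow {1..<n})"
  using inj_on_sub sub_subset sub_surj unfolding bij_betw_def by blast

lemma bij_betw_sub_between:
  assumes "C \<subseteq> {1..<n}"
  shows "bij_betw sub {\<beta> \<in> compositions n. A \<subseteq> sub \<beta> \<and> sub \<beta> \<subseteq> C} {B. A \<subseteq> B \<and> B \<subseteq> C}"
proof (rule bij_betw_subset[OF bij_betw_sub])
  show "sub ` {\<beta> \<in> compositions n. A \<subseteq> sub \<beta> \<and> sub \<beta> \<subseteq> C} = {B. A \<subseteq> B \<and> B \<subseteq> C}"
  proof (intro set_eqI iffI)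
    fix B assume B: "B \<in> {B. A \<subseteq> B \<and> B \<subseteq> C}"
    then obtain \<beta> where "\<beta> \<in> compositions n" "sub \<beta> = B" using sub_surj[of B n] assms by blast
    then show "B \<in> sub ` {\<beta> \<in> compositions n. A \<subseteq> sub \<beta> \<and> sub \<beta> \<subseteq> C}"
      using B by (intro image_eqI[of _ _ \<beta>]) auto
  qed auto
qed auto

lemma bij_betw_sub_refines:
  "bij_betw sub {\<beta> \<in> compositions n. refines \<beta> \<alpha>} {B. sub \<alpha> \<subseteq> B \<and> B \<subseteq> {1..<n}}"
proof -
  have "{\<beta> \<in> compositions n. refines \<beta> \<alpha>}
      = {\<beta> \<in> compositions n. sub \<alpha> \<subseteq> sub \<beta> \<and> sub \<beta> \<subseteq> {1..<n}}"
    using sub_subset unfolding refines_def by blast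
  then show ?thesis using bij_betw_sub_between[of "{1..<n}" n "sub \<alpha>"] by simp
qed

lemma finite_compositions [simp]: "finite (compositions n)"
  using bij_betw_finite[OF bij_betw_sub] by simp

text \<open>The index of the part covering position p, with parts and positions both counted from 0:
  part j covers \<open>psum \<alpha> j \<le> p < psum \<alpha> (Suc j)\<close>. Defining it by
  counting makes monotonicity in p immediate.\<close>

definition block :: "nat list \<Rightarrow> nat \<Rightarrow> nat" where
  "block \<alpha> p = card {s \<in> sub \<alpha>. s \<le> p}"

lemma block_eqI:
  assumes \<alpha>: "\<alpha> \<in> compositions n" and j: "j < length \<alpha>" "psum \<alpha> j \<le> p" "p < psum \<alpha> (Suc j)"
  shows "block \<alpha> p = j"
proof -
  have "psum \<alpha> i \<le> p \<longleftrightarrow> i \<le> j" if "i < length \<alpha>" for i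
    using psum_le_iff[OF \<alpha>, of i j] psum_le_iff[OF \<alpha>, of "Suc j" i] that j
    by (metis le_trans less_imp_le not_less not_less_eq_eq Suc_leI)
  then have "{s \<in> sub \<alpha>. s \<le> p} = psum \<alpha> ` {1..j}"
    using j(1) by (auto simp: sub_eq_image)
  moreover have "inj_on (psum \<alpha>) {1..j}"
    by (rule inj_on_subset[OF inj_on_psum[OF \<alpha>]]) (use j in auto)
  ultimately show ?thesis by (simp add: block_def card_image)
qed

lemma psum_block:
  assumes \<alpha>: "\<alpha> \<in> compositions n" and p: "p < n"
  shows "block \<alpha> p < length \<alpha>" "psum \<alpha> (block \<alpha> p) \<le> p" "p < psum \<alpha> (Suc (block \<alpha> p))"
proof -
  have "p < psum \<alpha> (length \<alpha>)" "\<not> p < psum \<alpha> 0"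
    using p psum_length[OF \<alpha>] by simp_all
  then obtain j where "j < length \<alpha>" "\<forall>i\<le>j. \<not> p < psum \<alpha> i" "p < psum \<alpha> (Suc j)"
    using ex_least_nat_less[of "\<lambda>j. p < psum \<alpha> j"] by blast
  moreover from this have "psum \<alpha> j \<le> p" by (meson le_refl not_less)
  ultimately show "block \<alpha> p < length \<alpha>" "psum \<alpha> (block \<alpha> p) \<le> p" "p < psum \<alpha> (Suc (block \<alpha> p))"
    using block_eqI[OF \<alpha>] by auto
qed

lemma block_psum: "\<alpha> \<in> compositions n \<Longrightarrow> j < length \<alpha> \<Longrightarrow> block \<alpha> (psum \<alpha> j) = j"
  using psum_strict_mono[of \<alpha> n j "Suc j"] by (intro block_eqI) auto

lemma card_block:
  assumes "\<alpha> \<in> compositions n" "j < length \<alpha>"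
  shows "card {p. p < n \<and> block \<alpha> p = j} = \<alpha> ! j"
proof -
  have "psum \<alpha> (Suc j) \<le> n"
    using psum_le_iff[OF assms(1), of "Suc j" "length \<alpha>"] psum_length[OF assms(1)] assms(2) by simp
  then have "{p. p < n \<and> block \<alpha> p = j} = {psum \<alpha> j..<psum \<alpha> (Suc j)}"
  proof (intro set_eqI iffI)
    fix p assume "p \<in> {p. p < n \<and> block \<alpha> p = j}"
    then show "p \<in> {psum \<alpha> j..<psum \<alpha> (Suc j)}" using psum_block(2,3)[OF assms(1), of p] by simp
  next
    fix p assume "p \<in> {psum \<alpha> j..<psum \<alpha> (Suc j)}"
    then show "p \<in> {p. p < n \<and> block \<alpha> p = j}"
      using block_eqI[OF assms, of p] \<open>psum \<alpha> (Suc j) \<le> n\<close> by simp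
  qed
  then show ?thesis using assms(2) by (simp add: psum_Suc)
qed

subsection \<open>The statistics \<open>s\<close> and \<open>\<xi>\<close> in terms of partial sums\<close>

lemma psum_diff:
  assumes "p \<le> q" "q \<le> length \<beta>"
  shows "psum \<beta> q = psum \<beta> p + (\<Sum>r = p + 1..q. \<beta> ! (r - 1))"
  using assms by (induction q rule: dec_induct) (auto simp: psum_Suc)

text \<open>The break i_j is the index at which the partial sums of \<beta> reach the j-th partial
  sum of \<alpha>; refinement says that they do reach it.\<close>

lemma is_breaks_exists:
  assumes \<alpha>: "\<alpha> \<in> compositions n" and \<beta>: "\<beta> \<in> compositions n" and ref: "refines \<beta> \<alpha>"
  shows "\<exists>i. is_breaks \<alpha> \<beta> i"
proof -
  have "\<exists>q\<le>length \<beta>. psum \<beta> q = psum \<alpha> j" if j: "j \<le> length \<alpha>" for j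
  proof -
    \<comment> \<open>\<open>sub\<close> leaves out 0 and n, so the two end breaks do not come from
      refinement.\<close>
    consider "j = 0" | "j = length \<alpha>" | "0 < j" "j < length \<alpha>"
      using j by (metis gr0I le_neq_implies_less)
    then show ?thesis
    proof cases
      case 1
      then show ?thesis by (intro exI[of _ 0]) simp
    next
      case 2
      then show ?thesis
        using psum_length[OF \<alpha>] psum_length[OF \<beta>] by (intro exI[of _ "length \<beta>"]) simp
    next
      case 3
      then have "psum \<alpha> j \<in> sub \<beta>"
        using ref psum_in_sub_iff[OF \<alpha>, of j] by (auto simp: refines_def)
      then obtain q where "q < length \<beta>" "psum \<alpha> j = psum \<beta> q" unfolding sub_eq_image by auto
      then show ?thesis by (intro exI[of _ q]) simp
    qed
  qed
  then obtain i where i: "i j \<le> length \<beta>" "psum \<beta> (i j) = psum \<alpha> j" if "j \<le> length \<alpha>" for j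
    by metis
  have mono: "i (j - 1) < i j" if "j \<in> {1..length \<alpha>}" for j
    using psum_strict_mono[OF \<alpha>, of "j - 1" j] psum_less_iff[OF \<beta>, of "i (j - 1)" "i j"]
      i[of j] i[of "j - 1"] that by auto
  moreover have "\<alpha> ! (j - 1) = (\<Sum>p = i (j - 1) + 1..i j. \<beta> ! (p - 1))" if "j \<in> {1..length \<alpha>}" for j
    using psum_diff[of "i (j - 1)" "i j" \<beta>] mono[OF that] i[of j] i[of "j - 1"] that
      psum_Suc[of "j - 1" \<alpha>] by auto
  moreover have "i 0 = 0" using i[of 0] psum_eq_iff[OF \<beta>, of "i 0" 0] by auto
  moreover have "i (length \<alpha>) = length \<beta>"
    using i[of "length \<alpha>"] psum_eq_iff[OF \<beta>, of "i (length \<alpha>)" "length \<beta>"]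
      psum_length[OF \<alpha>] psum_length[OF \<beta>] by auto
  ultimately show ?thesis unfolding is_breaks_def by blast
qed

text \<open>\<open>breaks\<close> is an arbitrary choice, so whatever is used of it must follow from
  \<open>is_breaks\<close> alone. For a composition \<beta> these two facts determine
  \<open>i j\<close> on the relevant range.\<close>

lemma is_breaks_psum:
  assumes br: "is_breaks \<alpha> \<beta> i" and j: "j \<le> length \<alpha>"
  shows "i j \<le> length \<beta>" "psum \<beta> (i j) = psum \<alpha> j"
proof -
  have step: "i j < i (Suc j)" "\<alpha> ! j = (\<Sum>p = i j + 1..i (Suc j). \<beta> ! (p - 1))"
    if "j < length \<alpha>" for j
    using br that by (auto simp: is_breaks_def dest!: bspec[of _ _ "Suc j"])
  \<comment> \<open>The function i increases and ends at \<open>length \<beta>\<close>, so the bound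
    travels downwards from the last break. It is needed first because \<open>psum_diff\<close> holds
    only up to the length.\<close>
  have le: "i j \<le> length \<beta>" if "j \<le> length \<alpha>" for j
    using that
  proof (induction j rule: inc_induct)
    case base
    then show ?case using br by (simp add: is_breaks_def)
  next
    case (step j)
    then show ?case using \<open>j < length \<alpha> \<Longrightarrow> i j < i (Suc j)\<close> by simp
  qed
  show "i j \<le> length \<beta>" using le j .
  show "psum \<beta> (i j) = psum \<alpha> j"
    using j
  proof (induction j)
    case 0
    then show ?case using br by (simp add: is_breaks_def)
  next
    case (Suc j)
    then show ?case
      using psum_diff[of "i j" "i (Suc j)" \<beta>] step[of j] le[of "Suc j"] by (simp add: psum_Suc)
  qed
qed

text \<open>For c in B this is the rank of c, counted from 1; for c between the elements of
  \<open>sub \<alpha>\<close> it is the number of the part of \<alpha> in whose interior c lies. One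
  function thus serves both \<open>xi\<close> and \<open>s_stat\<close>. The strict inequality makes
  the value independent of the elements of B from c upwards, which is what the induction in
  \<open>sum_intermediate_sets\<close> rests on.\<close>

definition weight :: "nat set \<Rightarrow> nat \<Rightarrow> nat" where
  "weight B c = Suc (card {b \<in> B. b < c})"

lemma weight_sub_eq_block: "c \<notin> sub \<alpha> \<Longrightarrow> weight (sub \<alpha>) c = Suc (block \<alpha> c)"
  unfolding weight_def block_def by (metis order_le_less)

text \<open>The partial sums of \<beta> strictly inside the j-th part of \<alpha> are those with
  index strictly between two consecutive breaks, and all of them have weight j. Grouping the new
  partial sums by weight gives the defining sum.\<close>

lemma s_stat_eq:
  assumes \<alpha>: "\<alpha> \<in> compositions n" and \<beta>: "\<beta> \<in> compositions n" and ref: "refines \<beta> \<alpha>"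
  shows "s_stat \<alpha> \<beta> = sum (weight (sub \<alpha>)) (sub \<beta> - sub \<alpha>)"
proof -
  define i where "i = breaks \<alpha> \<beta>"
  have "is_breaks \<alpha> \<beta> i"
    unfolding i_def breaks_def using is_breaks_exists[OF assms] by (rule someI_ex)
  note i = is_breaks_psum[OF this]
  let ?S = "sub \<beta> - sub \<alpha>"
  have w: "weight (sub \<alpha>) c = Suc (block \<alpha> c)" if "c \<in> ?S" for c
    using that by (simp add: weight_sub_eq_block)
  have S: "{c \<in> ?S. weight (sub \<alpha>) c = j} = psum \<beta> ` {i (j - 1)<..<i j}"
    if j: "j \<in> {1..length \<alpha>}" for j
  proof (intro set_eqI iffI)
    fix c assume "c \<in> {c \<in> ?S. weight (sub \<alpha>) c = j}"
    then have c: "c \<in> sub \<beta>" "c \<notin> sub \<alpha>" "block \<alpha> c = j - 1" using w j by auto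
    then obtain q where q: "1 \<le> q" "q < length \<beta>" "c = psum \<beta> q" by (auto simp: sub_eq_image)
    have "c < n" "0 < c" using sub_subset[OF \<beta>] c(1) by auto
    then have "psum \<alpha> (j - 1) \<le> c" "c < psum \<alpha> j" using psum_block[OF \<alpha>, of c] c(3) j by auto
    moreover have "c \<noteq> psum \<alpha> (j - 1)"
    \<comment> \<open>The first part starts at 0, which is not in \<open>sub \<alpha>\<close>; there
      the positivity of c is used instead.\<close>
    proof (cases "j = 1")
      case False
      then have "psum \<alpha> (j - 1) \<in> sub \<alpha>" using psum_in_sub_iff[OF \<alpha>, of "j - 1"] j by auto
      then show ?thesis using c(2) by metis
    qed (use \<open>0 < c\<close> in simp)
    ultimately have "psum \<beta> (i (j - 1)) < psum \<beta> q" "psum \<beta> q < psum \<beta> (i j)"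
      using i(2)[of j] i(2)[of "j - 1"] j q by auto
    then have "i (j - 1) < q" "q < i j"
      using psum_less_iff[OF \<beta>] i(1)[of j] i(1)[of "j - 1"] j q by auto
    then show "c \<in> psum \<beta> ` {i (j - 1)<..<i j}" using q by auto
  next
    fix c assume "c \<in> psum \<beta> ` {i (j - 1)<..<i j}"
    then obtain q where q: "i (j - 1) < q" "q < i j" "c = psum \<beta> q" by auto
    have ij: "i j \<le> length \<beta>" using i(1) j by simp
    have "psum \<beta> (i (j - 1)) < c" "c < psum \<beta> (i j)"
      using psum_strict_mono[OF \<beta>] q ij by auto
    then have c: "psum \<alpha> (j - 1) < c" "c < psum \<alpha> j" using i(2) j by auto
    then have b: "block \<alpha> c = j - 1" using block_eqI[OF \<alpha>, of "j - 1" c] j by auto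
    have "c \<notin> sub \<alpha>"
    proof
      assume "c \<in> sub \<alpha>"
      then obtain r where "r < length \<alpha>" "c = psum \<alpha> r" by (auto simp: sub_eq_image)
      then show False using c b block_psum[OF \<alpha>, of r] by auto
    qed
    moreover have "c \<in> sub \<beta>" using q ij by (auto simp: sub_eq_image)
    ultimately show "c \<in> {c \<in> ?S. weight (sub \<alpha>) c = j}" using w[of c] b j by auto
  qed
  have card: "card {c \<in> ?S. weight (sub \<alpha>) c = j} = i j - i (j - 1) - 1"
    if j: "j \<in> {1..length \<alpha>}" for j
  proof -
    have "inj_on (psum \<beta>) {i (j - 1)<..<i j}"
      by (rule inj_on_subset[OF inj_on_psum[OF \<beta>]]) (use i(1)[of j] j in auto)
    then show ?thesis unfolding S[OF j] by (simp add: card_image)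
  qed
  have "weight (sub \<alpha>) ` ?S \<subseteq> {1..length \<alpha>}"
  proof
    fix x assume "x \<in> weight (sub \<alpha>) ` ?S"
    then obtain c where c: "c \<in> ?S" "x = weight (sub \<alpha>) c" by blast
    then have "c < n" using sub_subset[OF \<beta>] by auto
    then show "x \<in> {1..length \<alpha>}" using psum_block(1)[OF \<alpha>, of c] w[OF c(1)] c(2) by auto
  qed
  then have "sum (weight (sub \<alpha>)) ?S
      = (\<Sum>j = 1..length \<alpha>. sum (weight (sub \<alpha>)) {c \<in> ?S. weight (sub \<alpha>) c = j})"
    by (intro sum.group[symmetric]) auto
  also have "\<dots> = (\<Sum>j = 1..length \<alpha>. j * (i j - i (j - 1) - 1))"
    by (intro sum.cong refl) (subst card[symmetric], auto)
  finally show ?thesis by (simp add: s_stat_def i_def)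
qed

text \<open>The j-th element of \<open>sub \<beta>\<close> has rank j, hence weight j. Since j is
  positive, the condition on \<open>xi\<close> says exactly that this element lies outside
  \<open>sub \<alpha>\<close>.\<close>

lemma prod_xi_eq:
  assumes \<beta>: "\<beta> \<in> compositions n"
  shows "(\<Prod>j\<in>{j \<in> {1..<length \<beta>}. xi \<alpha> \<beta> j = j}. f j)
    = (\<Prod>b\<in>sub \<beta> - sub \<alpha>. f (weight (sub \<beta>) b))"
proof -
  let ?J = "{j \<in> {1..<length \<beta>}. xi \<alpha> \<beta> j = j}"
  have "inj_on (psum \<beta>) ?J"
    by (rule inj_on_subset[OF inj_on_psum[OF \<beta>]]) auto
  moreover have "sub \<beta> - sub \<alpha> = psum \<beta> ` ?J"
    by (auto simp: sub_eq_image[of \<beta>] xi_def split: if_splits)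
  moreover have "weight (sub \<beta>) (psum \<beta> j) = j" if "j \<in> ?J" for j
  proof -
    have j: "j < length \<beta>" "1 \<le> j" using that by auto
    then have "{b \<in> sub \<beta>. b < psum \<beta> j} = psum \<beta> ` {1..<j}"
      using psum_less_iff[OF \<beta>] by (auto simp: sub_eq_image)
    moreover have "inj_on (psum \<beta>) {1..<j}"
      by (rule inj_on_subset[OF inj_on_psum[OF \<beta>]]) (use j in auto)
    ultimately show ?thesis using j by (simp add: weight_def card_image)
  qed
  ultimately show ?thesis by (simp add: prod.reindex)
qed

section \<open>The identity for sums over intermediate sets\<close>

lemma weight_cong: "{b \<in> B. b < c} = {b \<in> B'. b < c} \<Longrightarrow> weight B c = weight B' c"
  by (simp add: weight_def)

text \<open>Deciding membership in \<open>B\<close> for the elements of \<open>C - A\<close> in increasing order, each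
  contributes \<open>(1 - t ^ j) + t ^ j = 1\<close>, where \<open>j\<close> depends on the earlier decisions only.\<close>

lemma sum_intermediate_sets:
  fixes t :: "'a::comm_ring_1" and C :: "nat set"
  assumes "finite C" "A \<subseteq> C"
  shows "(\<Sum>B\<in>{B. A \<subseteq> B \<and> B \<subseteq> C}.
    (\<Prod>b\<in>B - A. 1 - t ^ weight B b) * t ^ sum (weight B) (C - B)) = 1"
  using assms
proof (induction C arbitrary: A rule: finite_linorder_max_induct)
  case empty
  then have "{B. A \<subseteq> B \<and> B \<subseteq> {}} = {{}}" by auto
  then show ?case by simp
next
  case (insert m C)
  let ?h = "\<lambda>A C B. (\<Prod>b\<in>B - A. 1 - t ^ weight B b) * t ^ sum (weight B) (C - B)"
  let ?I = "\<lambda>A C. {B. A \<subseteq> B \<and> B \<subseteq> C}"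
  have m: "m \<notin> C" using insert.hyps by auto
  have fin: "finite (?I A' C)" for A'
    by (rule finite_subset[of _ "Pow C"]) (use insert.hyps in auto)
  \<comment> \<open>m exceeds all of C and weights count only strictly smaller elements, so adding m
    to B changes none of these weights, not even that of m.\<close>
  have w: "weight (insert m B) c = weight B c" if "c \<in> insert m C" for B c
    using that insert.hyps by (intro weight_cong) auto
  have inj: "inj_on (insert m) (?I A' C)" for A'
    using m by (auto simp: inj_on_def)
  show ?case
  proof (cases "m \<in> A")
    case True
    let ?A = "A - {m}"
    have A: "?A \<subseteq> C" using insert.prems m by auto
    have "?I A (insert m C) = insert m ` ?I ?A C"
    proof (intro set_eqI iffI)
      fix B assume B: "B \<in> ?I A (insert m C)"
      then have "B = insert m (B - {m})" "B - {m} \<in> ?I ?A C" using True by auto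
      then show "B \<in> insert m ` ?I ?A C" by blast
    qed (use True in auto)
    then have "sum (?h A (insert m C)) (?I A (insert m C))
        = (\<Sum>B\<in>?I ?A C. ?h A (insert m C) (insert m B))"
      by (simp add: sum.reindex[OF inj])
    also have "\<dots> = sum (?h ?A C) (?I ?A C)"
    proof (intro sum.cong refl)
      fix B assume B: "B \<in> ?I ?A C"
      then have "insert m B - A = B - ?A" "insert m C - insert m B = C - B" using m True by auto
      moreover have "(\<Prod>b\<in>B - ?A. 1 - t ^ weight (insert m B) b) = (\<Prod>b\<in>B - ?A. 1 - t ^ weight B b)"
        using B by (intro prod.cong refl) (simp add: w subset_iff)
      moreover have "sum (weight (insert m B)) (C - B) = sum (weight B) (C - B)"
        by (intro sum.cong refl) (simp add: w)
      ultimately show "?h A (insert m C) (insert m B) = ?h ?A C B" by simp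
    qed
    finally show ?thesis using insert.IH[OF A] by simp
  next
    case False
    then have A: "A \<subseteq> C" using insert.prems by auto
    have "?I A (insert m C) = ?I A C \<union> insert m ` ?I A C"
    proof (intro set_eqI iffI)
      fix B assume B: "B \<in> ?I A (insert m C)"
      show "B \<in> ?I A C \<union> insert m ` ?I A C"
      proof (cases "m \<in> B")
        case True
        then have "B = insert m (B - {m})" "B - {m} \<in> ?I A C" using B False by auto
        then show ?thesis by blast
      qed (use B in auto)
    qed auto
    moreover have "?I A C \<inter> insert m ` ?I A C = {}" using m by auto
    ultimately have "sum (?h A (insert m C)) (?I A (insert m C))
        = sum (?h A (insert m C)) (?I A C) + (\<Sum>B\<in>?I A C. ?h A (insert m C) (insert m B))"
      using fin by (simp add: sum.union_disjoint sum.reindex[OF inj])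
    also have "\<dots> = (\<Sum>B\<in>?I A C. ?h A (insert m C) B + ?h A (insert m C) (insert m B))"
      by (simp add: sum.distrib)
    also have "\<dots> = sum (?h A C) (?I A C)"
    proof (intro sum.cong refl)
      fix B assume B: "B \<in> ?I A C"
      then have mB: "m \<notin> B" and finB: "finite B"
        using m insert.hyps finite_subset by blast+
      have s1: "insert m C - B = insert m (C - B)" "insert m C - insert m B = C - B"
        "insert m B - A = insert m (B - A)" using m mB False by auto
      have s2: "(\<Prod>b\<in>B - A. 1 - t ^ weight (insert m B) b) = (\<Prod>b\<in>B - A. 1 - t ^ weight B b)"
        using B by (intro prod.cong refl) (simp add: w subset_iff)
      have s3: "sum (weight (insert m B)) (C - B) = sum (weight B) (C - B)"
        by (intro sum.cong refl) (simp add: w)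
      have "?h A (insert m C) B = t ^ weight B m * ?h A C B"
        using m insert.hyps by (simp add: s1 power_add)
      moreover have "?h A (insert m C) (insert m B) = (1 - t ^ weight B m) * ?h A C B"
        using mB finB by (simp add: s1 s2 s3 w)
      ultimately show "?h A (insert m C) B + ?h A (insert m C) (insert m B) = ?h A C B"
        by (simp add: algebra_simps)
    qed
    finally show ?thesis using insert.IH[OF A] by simp
  qed
qed

subsection \<open>Fundamental and monomial quasisymmetric polynomials as sums over words\<close>

definition words :: "nat \<Rightarrow> nat \<Rightarrow> nat list set" where
  "words N n = {w. length w = n \<and> set w \<subseteq> {1..N} \<and> sorted w}"

text \<open>The number j stands for the gap after the first j letters, so that gaps match partial
  sums. \<open>F\<close> collects the words whose rise set contains \<open>sub \<alpha>\<close>,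
  \<open>M\<close> those whose rise set equals it.\<close>

definition rises :: "nat list \<Rightarrow> nat set" where
  "rises w = {j \<in> {1..<length w}. w ! (j - 1) < w ! j}"

definition word_monom :: "nat list \<Rightarrow> 'a::comm_ring_1 mpoly" where
  "word_monom w = (\<Prod>j<length w. X (w ! j))"

lemma finite_words [simp]: "finite (words N n)"
  by (rule finite_subset[OF _ finite_lists_length_eq[of "{1..N}" n]]) (auto simp: words_def)

lemma F_eq:
  assumes "\<alpha> \<in> compositions n"
  shows "F N \<alpha> = sum word_monom {w \<in> words N n. sub \<alpha> \<subseteq> rises w}"
proof -
  have n: "sum_list \<alpha> = n" using assms by (simp add: compositions_def)
  have "{w. length w = n \<and> set w \<subseteq> {1..N} \<and> sorted w \<and> (\<forall>j\<in>sub \<alpha>. w ! (j - 1) < w ! j)}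
      = {w \<in> words N n. sub \<alpha> \<subseteq> rises w}"
    using sub_subset[OF assms] by (auto simp: words_def rises_def)
  then show ?thesis by (auto simp: F_def n word_monom_def words_def intro!: sum.cong)
qed

text \<open>A monomial with exponents \<alpha> at the variables i, written out letter by letter as a
  weakly increasing word. It is one direction of the bijection in \<open>M_eq\<close>; the other
  reads the letter at the start of each part.\<close>

definition spread :: "nat list \<Rightarrow> nat list \<Rightarrow> nat list" where
  "spread \<alpha> i = map (\<lambda>p. i ! block \<alpha> p) [0..<sum_list \<alpha>]"

lemma block_mono: "p \<le> q \<Longrightarrow> block \<alpha> p \<le> block \<alpha> q"
  unfolding block_def by (intro card_mono) auto

lemma spread_in_words:
  assumes \<alpha>: "\<alpha> \<in> compositions n"
    and i: "length i = length \<alpha>" "set i \<subseteq> {1..N}" "sorted_wrt (<) i"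
  shows "spread \<alpha> i \<in> words N n" "rises (spread \<alpha> i) = sub \<alpha>"
proof -
  have n: "sum_list \<alpha> = n" using \<alpha> by (simp add: compositions_def)
  have lt: "i ! a < i ! b \<longleftrightarrow> a < b" if "a < length \<alpha>" "b < length \<alpha>" for a b
    using sorted_wrt_nth_less[OF i(3), of a b] sorted_wrt_nth_less[OF i(3), of b a] that i(1)
    by (cases a b rule: linorder_cases) auto
  have "i ! block \<alpha> p \<in> {1..N}" if "p < n" for p
    using nth_mem[of "block \<alpha> p" i] psum_block(1)[OF \<alpha> that] i(1,2) by (metis subsetD)
  then have "set (spread \<alpha> i) \<subseteq> {1..N}" by (auto simp: spread_def n)
  moreover have "i ! block \<alpha> p \<le> i ! block \<alpha> q" if "p \<le> q" "q < n" for p q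
    using lt[of "block \<alpha> q" "block \<alpha> p"] block_mono[OF that(1), of \<alpha>]
      psum_block(1)[OF \<alpha>, of p] psum_block(1)[OF \<alpha>, of q] that by simp
  then have "sorted (spread \<alpha> i)"
    unfolding sorted_iff_nth_mono by (simp add: spread_def n)
  ultimately show "spread \<alpha> i \<in> words N n" by (simp add: words_def) (simp add: spread_def n)
  \<comment> \<open>\<open>block\<close> counts partial sums, so it steps up from position j - 1 to
    position j exactly when j is itself a partial sum.\<close>
  have "block \<alpha> (j - 1) < block \<alpha> j \<longleftrightarrow> j \<in> sub \<alpha>" if "j \<in> {1..<n}" for j
  proof
    assume "block \<alpha> (j - 1) < block \<alpha> j"
    then have "{s \<in> sub \<alpha>. s \<le> j - 1} \<noteq> {s \<in> sub \<alpha>. s \<le> j}" by (auto simp: block_def)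
    then obtain s where "s \<in> sub \<alpha>" "s \<le> j" "\<not> s \<le> j - 1" by auto
    moreover from this have "s = j" by simp
    ultimately show "j \<in> sub \<alpha>" by simp
  next
    assume "j \<in> sub \<alpha>"
    then have "j \<in> {s \<in> sub \<alpha>. s \<le> j}" "j \<notin> {s \<in> sub \<alpha>. s \<le> j - 1}" using that by auto
    then have "{s \<in> sub \<alpha>. s \<le> j - 1} \<subset> {s \<in> sub \<alpha>. s \<le> j}" by auto
    then show "block \<alpha> (j - 1) < block \<alpha> j" by (simp add: block_def psubset_card_mono)
  qed
  moreover have "spread \<alpha> i ! (j - 1) < spread \<alpha> i ! j \<longleftrightarrow> block \<alpha> (j - 1) < block \<alpha> j"
    if "j \<in> {1..<n}" for j
  proof -
    have "j - 1 < n" "j < n" using that by auto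
    then show ?thesis
      using lt[of "block \<alpha> (j - 1)" "block \<alpha> j"] psum_block(1)[OF \<alpha>]
      by (simp add: spread_def n del: One_nat_def)
  qed
  moreover have "length (spread \<alpha> i) = n" by (simp add: spread_def n)
  ultimately show "rises (spread \<alpha> i) = sub \<alpha>"
    using sub_subset[OF \<alpha>] unfolding rises_def by blast
qed

text \<open>No gap in the interior of a part is a rise, and a weakly increasing word is constant
  where it has no rise. Hence the letters at the starts of the parts determine the word.\<close>

lemma constant_on_blocks:
  assumes \<alpha>: "\<alpha> \<in> compositions n" and w: "w \<in> words N n" "rises w = sub \<alpha>" and p: "p < n"
  shows "w ! p = w ! psum \<alpha> (block \<alpha> p)"
proof -
  have const: "w ! q = w ! psum \<alpha> j" if j: "j < length \<alpha>" "psum \<alpha> j \<le> q" "q < psum \<alpha> (Suc j)" for j q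
    using j(2,3)
  proof (induction q rule: dec_induct)
    case (step q)
    have "Suc q \<notin> sub \<alpha>"
    proof
      assume "Suc q \<in> sub \<alpha>"
      then obtain r where r: "r < length \<alpha>" "Suc q = psum \<alpha> r" by (auto simp: sub_eq_image)
      then have "r = j" using block_psum[OF \<alpha> r(1)] block_eqI[OF \<alpha> j(1), of "Suc q"] step by simp
      then show False using r step by simp
    qed
    moreover have "Suc q < n"
      using step.prems psum_le_iff[OF \<alpha>, of "Suc j" "length \<alpha>"] psum_length[OF \<alpha>] j(1) by simp
    ultimately have "\<not> w ! q < w ! Suc q" "w ! q \<le> w ! Suc q"
      using w sorted_nth_mono[of w q "Suc q"] by (auto simp: rises_def words_def)
    then show ?case using step by simp
  qed simp
  show ?thesis using const psum_block[OF \<alpha> p] by blast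
qed

lemma word_monom_spread:
  assumes \<alpha>: "\<alpha> \<in> compositions n"
  shows "word_monom (spread \<alpha> i) = (\<Prod>j<length \<alpha>. X (i ! j) ^ (\<alpha> ! j))"
proof -
  have n: "sum_list \<alpha> = n" using \<alpha> by (simp add: compositions_def)
  have "word_monom (spread \<alpha> i) = (\<Prod>p<n. X (i ! block \<alpha> p))"
    by (simp add: word_monom_def spread_def n)
  also have "\<dots> = (\<Prod>j<length \<alpha>. \<Prod>p\<in>{p \<in> {..<n}. block \<alpha> p = j}. X (i ! block \<alpha> p))"
    using psum_block(1)[OF \<alpha>] by (intro prod.group[symmetric]) auto
  also have "\<dots> = (\<Prod>j<length \<alpha>. X (i ! j) ^ (\<alpha> ! j))"
    by (intro prod.cong refl) (simp add: card_block[OF \<alpha>])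
  finally show ?thesis .
qed

lemma M_eq:
  assumes \<alpha>: "\<alpha> \<in> compositions n"
  shows "M N \<alpha> = sum word_monom {w \<in> words N n. rises w = sub \<alpha>}"
proof -
  have n: "sum_list \<alpha> = n" using \<alpha> by (simp add: compositions_def)
  have lt: "psum \<alpha> j < n" if "j < length \<alpha>" for j
    using psum_strict_mono[OF \<alpha> that] psum_length[OF \<alpha>] by simp
  show ?thesis
    unfolding M_def
  proof (rule sum.reindex_bij_witness[where i = "\<lambda>w. map (\<lambda>j. w ! psum \<alpha> j) [0..<length \<alpha>]"
        and j = "spread \<alpha>"], goal_cases)
    case (1 i)
    then show ?case
      using lt block_psum[OF \<alpha>] by (intro nth_equalityI) (auto simp: spread_def n)
  next
    case (2 i)
    then show ?case using spread_in_words[OF \<alpha>] by auto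
  next
    case (3 w)
    then show ?case
      using constant_on_blocks[OF \<alpha>, of w N] psum_block(1)[OF \<alpha>]
      by (intro nth_equalityI) (auto simp: spread_def n words_def)
  next
    case (4 w)
    then have w: "length w = n" "set w \<subseteq> {1..N}" "sorted w" "rises w = sub \<alpha>"
      by (auto simp: words_def)
    have "w ! psum \<alpha> a < w ! psum \<alpha> b" if "a < b" "b < length \<alpha>" for a b
    proof -
      \<comment> \<open>The letter just before the start of part b separates the two: it is at least
        the letter at the start of part a, and the rise puts it strictly below the letter at the
        start of part b.\<close>
      have "psum \<alpha> b \<in> rises w" using that psum_in_sub_iff[OF \<alpha>, of b] w by simp
      then have "w ! (psum \<alpha> b - 1) < w ! psum \<alpha> b" by (simp add: rises_def)
      moreover have "psum \<alpha> a \<le> psum \<alpha> b - 1"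
        using psum_strict_mono[OF \<alpha>, of a b] that by simp
      moreover have "w ! psum \<alpha> a \<le> w ! (psum \<alpha> b - 1)"
        using calculation w lt[OF that(2)] by (intro sorted_nth_mono) auto
      ultimately show ?thesis by simp
    qed
    then have "sorted_wrt (<) (map (\<lambda>j. w ! psum \<alpha> j) [0..<length \<alpha>])"
      by (simp add: sorted_wrt_iff_nth_less)
    moreover have "w ! psum \<alpha> j \<in> {1..N}" if "j < length \<alpha>" for j
      using nth_mem[of "psum \<alpha> j" w] lt[OF that] w(1,2) by (metis subsetD)
    then have "set (map (\<lambda>j. w ! psum \<alpha> j) [0..<length \<alpha>]) \<subseteq> {1..N}" by auto
    ultimately show ?case by simp
  next
    case (5 i)
    then show ?case by (simp add: word_monom_spread[OF \<alpha>])
  qed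
qed

section \<open>Inclusion-exclusion: monomial in terms of fundamental polynomials\<close>

lemma sum_neg_one_intermediate_sets:
  assumes "finite D"
  shows "(\<Sum>C\<in>{C. A \<subseteq> C \<and> C \<subseteq> D}. (- 1) ^ card (C - A)) = (if A = D then 1 else 0 :: 'a::comm_ring_1)"
proof (cases "A \<subseteq> D")
  case True
  have fin: "finite (D - A)" using assms by simp
  have "(\<Sum>C\<in>{C. A \<subseteq> C \<and> C \<subseteq> D}. (- 1) ^ card (C - A)) = (\<Sum>S\<in>Pow (D - A). (- 1 :: 'a) ^ card S)"
    using True
    by (intro sum.reindex_bij_witness[where i = "\<lambda>S. S \<union> A" and j = "\<lambda>C. C - A"])
      (auto simp: Un_absorb2)
  \<comment> \<open>The alternating sum over subsets is the expanded product of card (D - A) factors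
    1 - 1, which is nonzero only when it is empty.\<close>
  also have "\<dots> = (\<Prod>x\<in>D - A. - 1 + 1)"
    unfolding prod_add[OF fin] by (intro sum.cong refl) simp
  also have "\<dots> = (if A = D then 1 else 0)"
    using True fin by (cases "A = D") (auto simp: power_0_left card_eq_0_iff)
  finally show ?thesis .
next
  case False
  then have "{C. A \<subseteq> C \<and> C \<subseteq> D} = {}" "A \<noteq> D" by auto
  then show ?thesis by (simp only: sum.empty if_False)
qed

section \<open>Scalar multiplication over a commutative ring (the interpretation
  \<open>mpoly\<close> covers fields)\<close>

lemma cmul_zero_left [simp]: "cmul 0 p = 0"
  by (simp add: cmul_def)

lemma cmul_add_left: "cmul (a + b) p = cmul a p + cmul b p"
  by (simp add: cmul_def single_add distrib_right)

lemma cmul_one [simp]: "cmul 1 p = p"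
  by (simp add: cmul_def)

lemma cmul_cmul: "cmul a (cmul b p) = cmul (a * b) p"
  by (simp add: cmul_def mult_single flip: mult.assoc)

lemma cmul_sum_right: "cmul c (sum f S) = (\<Sum>x\<in>S. cmul c (f x))"
  by (simp add: cmul_def sum_distrib_left)

lemma cmul_sum_left: "cmul (sum f S) p = (\<Sum>x\<in>S. cmul (f x) p)"
  by (induction S rule: infinite_finite_induct) (auto simp: cmul_add_left)

text \<open>After exchanging the sums, each word w carries the alternating sum over all C between
  \<open>sub \<alpha>\<close> and \<open>rises w\<close>. It vanishes unless the two ends agree,
  which leaves exactly the words of \<open>M_eq\<close>.\<close>

lemma M_eq_sum_F:
  assumes \<alpha>: "\<alpha> \<in> compositions n"
  shows "M N \<alpha> = (\<Sum>\<gamma>\<in>{\<gamma> \<in> compositions n. refines \<gamma> \<alpha>}.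
    cmul ((- 1) ^ card (sub \<gamma> - sub \<alpha>)) (F N \<gamma>) :: 'a::comm_ring_1 mpoly)"
proof -
  let ?I = "{C. sub \<alpha> \<subseteq> C \<and> C \<subseteq> {1..<n}}"
  have fin: "finite ?I" by (rule finite_subset[of _ "Pow {1..<n}"]) auto
  have "(\<Sum>\<gamma>\<in>{\<gamma> \<in> compositions n. refines \<gamma> \<alpha>}.
        cmul ((- 1) ^ card (sub \<gamma> - sub \<alpha>)) (F N \<gamma>) :: 'a mpoly)
      = (\<Sum>\<gamma>\<in>{\<gamma> \<in> compositions n. refines \<gamma> \<alpha>}. cmul ((- 1) ^ card (sub \<gamma> - sub \<alpha>))
          (sum word_monom {w \<in> words N n. sub \<gamma> \<subseteq> rises w}))"
    by (intro sum.cong refl) (simp add: F_eq[where n = n])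
  also have "\<dots> = (\<Sum>C\<in>?I. cmul ((- 1) ^ card (C - sub \<alpha>))
      (sum word_monom {w \<in> words N n. C \<subseteq> rises w}))"
    by (rule sum.reindex_bij_betw[OF bij_betw_sub_refines])
  also have "\<dots> = (\<Sum>C\<in>?I. \<Sum>w | w \<in> words N n \<and> C \<subseteq> rises w.
      cmul ((- 1) ^ card (C - sub \<alpha>)) (word_monom w))"
    by (simp add: cmul_sum_right)
  also have "\<dots> = (\<Sum>w\<in>words N n. \<Sum>C | C \<in> ?I \<and> C \<subseteq> rises w.
      cmul ((- 1) ^ card (C - sub \<alpha>)) (word_monom w))"
    by (rule sum.swap_restrict) (use fin in auto)
  also have "\<dots> = (\<Sum>w\<in>words N n. if rises w = sub \<alpha> then word_monom w else 0)"
  proof (intro sum.cong refl)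
    fix w assume "w \<in> words N n"
    then have "rises w \<subseteq> {1..<n}" by (auto simp: words_def rises_def)
    then have "{C. C \<in> ?I \<and> C \<subseteq> rises w} = {C. sub \<alpha> \<subseteq> C \<and> C \<subseteq> rises w}" by auto
    then have "(\<Sum>C | C \<in> ?I \<and> C \<subseteq> rises w. cmul ((- 1) ^ card (C - sub \<alpha>)) (word_monom w))
        = cmul (\<Sum>C | sub \<alpha> \<subseteq> C \<and> C \<subseteq> rises w. (- 1) ^ card (C - sub \<alpha>)) (word_monom w :: 'a mpoly)"
      by (simp only: cmul_sum_left)
    also have "\<dots> = (if rises w = sub \<alpha> then word_monom w else 0)"
      by (subst sum_neg_one_intermediate_sets) (auto simp: rises_def)
    finally show "(\<Sum>C | C \<in> ?I \<and> C \<subseteq> rises w. cmul ((- 1) ^ card (C - sub \<alpha>)) (word_monom w))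
        = (if rises w = sub \<alpha> then word_monom w else 0 :: 'a mpoly)" .
  qed
  also have "\<dots> = M N \<alpha>"
    by (simp only: M_eq[OF \<alpha>] sum.inter_filter[OF finite_words])
  finally show ?thesis by simp
qed

section \<open>Monomial in terms of Hall-Littlewood polynomials\<close>

definition MG_coeff :: "'a::comm_ring_1 \<Rightarrow> nat list \<Rightarrow> nat list \<Rightarrow> 'a" where
  "MG_coeff t \<alpha> \<beta> = (- 1) ^ (length \<beta> - length \<alpha>) *
     (\<Prod>j\<in>{j \<in> {1..<length \<beta>}. xi \<alpha> \<beta> j = j}. 1 - t ^ j)"

text \<open>In the coefficient of \<open>F N \<gamma>\<close> on the right, the signs of the steps
  from \<alpha> to \<beta> and from \<beta> to \<gamma> multiply to a sign depending on \<alpha> and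
  \<gamma> only, and \<open>sum_intermediate_sets\<close> evaluates the remaining sum over \<beta>
  to 1. What is left is the expansion in \<open>M_eq_sum_F\<close>.\<close>

lemma M_eq_sum_G:
  fixes t :: "'a::comm_ring_1"
  assumes \<alpha>: "\<alpha> \<in> compositions n"
  shows "M N \<alpha> = (\<Sum>\<beta>\<in>{\<beta> \<in> compositions n. refines \<beta> \<alpha>}. cmul (MG_coeff t \<alpha> \<beta>) (G N t \<beta>))"
proof -
  let ?R = "\<lambda>\<alpha>. {\<beta> \<in> compositions n. refines \<beta> \<alpha>}"
  \<comment> \<open>Both kinds of coefficients are written as functions of the sets of partial sums,
    so that \<open>sub\<close> can carry the sum over \<beta> to a sum over intermediate
    sets.\<close>
  define c where "c A B = (- 1) ^ card (B - A) * (\<Prod>b\<in>B - A. 1 - t ^ weight B b)" for A B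
  define d where "d B C = (- 1) ^ card (C - B) * t ^ sum (weight B) (C - B)" for B C :: "nat set"
  have c: "MG_coeff t \<alpha> \<beta> = c (sub \<alpha>) (sub \<beta>)" if "\<beta> \<in> ?R \<alpha>" for \<beta>
    using that unfolding MG_coeff_def c_def
    by (subst prod_xi_eq[of _ n]) (auto simp: length_diff_eq_card[OF \<alpha>])
  have G: "G N t \<beta> = (\<Sum>\<gamma>\<in>?R \<beta>. cmul (d (sub \<beta>) (sub \<gamma>)) (F N \<gamma>))" if "\<beta> \<in> compositions n" for \<beta>
  proof -
    have "sum_list \<beta> = n" using that by (simp add: compositions_def)
    then show ?thesis using that
      unfolding G_def by (auto simp: d_def length_diff_eq_card s_stat_eq intro!: sum.cong)
  qed
  have "(\<Sum>\<beta>\<in>?R \<alpha>. cmul (MG_coeff t \<alpha> \<beta>) (G N t \<beta>))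
      = (\<Sum>\<beta>\<in>?R \<alpha>. \<Sum>\<gamma> | \<gamma> \<in> ?R \<alpha> \<and> refines \<gamma> \<beta>.
          cmul (c (sub \<alpha>) (sub \<beta>) * d (sub \<beta>) (sub \<gamma>)) (F N \<gamma>))"
  proof (intro sum.cong refl)
    fix \<beta> assume \<beta>: "\<beta> \<in> ?R \<alpha>"
    then have "?R \<beta> = {\<gamma>. \<gamma> \<in> ?R \<alpha> \<and> refines \<gamma> \<beta>}" by (auto simp: refines_def)
    then show "cmul (MG_coeff t \<alpha> \<beta>) (G N t \<beta>) = (\<Sum>\<gamma> | \<gamma> \<in> ?R \<alpha> \<and> refines \<gamma> \<beta>.
          cmul (c (sub \<alpha>) (sub \<beta>) * d (sub \<beta>) (sub \<gamma>)) (F N \<gamma>))"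
      using \<beta> G[of \<beta>] c[of \<beta>] by (simp add: cmul_sum_right cmul_cmul)
  qed
  also have "\<dots> = (\<Sum>\<gamma>\<in>?R \<alpha>. \<Sum>\<beta> | \<beta> \<in> ?R \<alpha> \<and> refines \<gamma> \<beta>.
          cmul (c (sub \<alpha>) (sub \<beta>) * d (sub \<beta>) (sub \<gamma>)) (F N \<gamma>))"
    by (rule sum.swap_restrict) auto
  also have "\<dots> = (\<Sum>\<gamma>\<in>?R \<alpha>. cmul ((- 1) ^ card (sub \<gamma> - sub \<alpha>)) (F N \<gamma>))"
  proof (intro sum.cong refl)
    fix \<gamma> assume \<gamma>: "\<gamma> \<in> ?R \<alpha>"
    let ?A = "sub \<alpha>" and ?C = "sub \<gamma>"
    have AC: "?A \<subseteq> ?C" "?C \<subseteq> {1..<n}" using \<gamma> sub_subset by (auto simp: refines_def)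
    have "{\<beta>. \<beta> \<in> ?R \<alpha> \<and> refines \<gamma> \<beta>}
        = {\<beta> \<in> compositions n. ?A \<subseteq> sub \<beta> \<and> sub \<beta> \<subseteq> ?C}"
      by (auto simp: refines_def)
    then have "bij_betw sub {\<beta>. \<beta> \<in> ?R \<alpha> \<and> refines \<gamma> \<beta>} {B. ?A \<subseteq> B \<and> B \<subseteq> ?C}"
      using bij_betw_sub_between[OF AC(2), of ?A] by simp
    then have "(\<Sum>\<beta> | \<beta> \<in> ?R \<alpha> \<and> refines \<gamma> \<beta>. c ?A (sub \<beta>) * d (sub \<beta>) ?C)
        = (\<Sum>B | ?A \<subseteq> B \<and> B \<subseteq> ?C. c ?A B * d B ?C)"
      by (rule sum.reindex_bij_betw)
    also have "\<dots> = (\<Sum>B | ?A \<subseteq> B \<and> B \<subseteq> ?C. (- 1) ^ card (?C - ?A) *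
        ((\<Prod>b\<in>B - ?A. 1 - t ^ weight B b) * t ^ sum (weight B) (?C - B)))"
    proof (intro sum.cong refl)
      fix B assume B: "B \<in> {B. ?A \<subseteq> B \<and> B \<subseteq> ?C}"
      then have "finite B" using finite_subset[of B ?C] by auto
      moreover have "?C - ?A = (B - ?A) \<union> (?C - B)" using B by auto
      ultimately have "card (?C - ?A) = card (B - ?A) + card (?C - B)"
        by (simp add: card_Un_disjoint disjoint_iff)
      then show "c ?A B * d B ?C = (- 1) ^ card (?C - ?A) *
        ((\<Prod>b\<in>B - ?A. 1 - t ^ weight B b) * t ^ sum (weight B) (?C - B))"
        by (simp add: c_def d_def power_add mult_ac)
    qed
    also have "\<dots> = (- 1) ^ card (?C - ?A)"
      using AC by (simp add: sum_intermediate_sets flip: sum_distrib_left)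
    finally show "(\<Sum>\<beta> | \<beta> \<in> ?R \<alpha> \<and> refines \<gamma> \<beta>. cmul (c ?A (sub \<beta>) * d (sub \<beta>) ?C) (F N \<gamma>))
        = cmul ((- 1) ^ card (?C - ?A)) (F N \<gamma>)"
      by (simp flip: cmul_sum_left)
  qed
  finally show ?thesis by (simp add: M_eq_sum_F[OF \<alpha>])
qed

subsection \<open>Linear independence\<close>

definition word_exponent :: "nat list \<Rightarrow> nat \<Rightarrow>\<^sub>0 nat" where
  "word_exponent w = sum_list (map (\<lambda>x. Poly_Mapping.single x 1) w)"

lemma word_monom_eq_single: "word_monom w = Poly_Mapping.single (word_exponent w) 1"
proof -
  have "prod_list (map X w) = Poly_Mapping.single (word_exponent w) (1::'a::comm_ring_1)" for w
    by (induction w) (auto simp: word_exponent_def X_def mult_single)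
  then show ?thesis
    by (simp add: word_monom_def prod.list_conv_set_nth atLeast0LessThan)
qed

text \<open>The exponent of a variable is the multiplicity of its letter, and a sorted word is
  determined by its multiset of letters.\<close>

lemma word_exponent_inj:
  assumes "word_exponent w = word_exponent w'" "sorted w" "sorted w'"
  shows "w = w'"
proof -
  have "Poly_Mapping.lookup (word_exponent w) x = count (mset w) x" for w x
    by (induction w) (auto simp: word_exponent_def lookup_add lookup_single when_def)
  then have "mset w = mset w'" using assms(1) by (metis multiset_eqI)
  then show ?thesis using assms(2,3) by (metis properties_for_sort)
qed

lemma lookup_M:
  assumes "\<alpha> \<in> compositions n" "w \<in> words N n"
  shows "Poly_Mapping.lookup (M N \<alpha>) (word_exponent w) = (if rises w = sub \<alpha> then 1 else 0)"
proof -
  let ?W = "{v \<in> words N n. rises v = sub \<alpha>}"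
  have "Poly_Mapping.lookup (M N \<alpha>) (word_exponent w) = (\<Sum>v\<in>?W. if v = w then 1 else 0)"
    unfolding M_eq[OF assms(1)] lookup_sum
  proof (intro sum.cong refl)
    fix v assume "v \<in> ?W"
    then have "word_exponent v = word_exponent w \<longleftrightarrow> v = w"
      using assms(2) word_exponent_inj[of v w] by (auto simp: words_def)
    then show "Poly_Mapping.lookup (word_monom v) (word_exponent w) = (if v = w then 1 else 0)"
      by (simp add: word_monom_eq_single lookup_single when_def)
  qed
  then show ?thesis using assms(2) by simp
qed

text \<open>Such a word uses \<open>length \<alpha>\<close> distinct letters. Positive parts give
  \<open>length \<alpha> \<le> n\<close>, so \<open>n \<le> N\<close> provides enough of them, and
  the letters from 1 to \<open>length \<alpha>\<close> will do.\<close>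

lemma word_with_rises_exists:
  assumes "\<alpha> \<in> compositions n" "n \<le> N"
  shows "\<exists>w\<in>words N n. rises w = sub \<alpha>"
proof -
  let ?i = "[1..<Suc (length \<alpha>)]"
  have "length \<alpha> \<le> sum_list \<alpha>" if "\<forall>a\<in>set \<alpha>. 0 < a" for \<alpha> :: "nat list"
    using that by (induction \<alpha>) auto
  then have "length \<alpha> \<le> n" using assms(1) by (auto simp: compositions_def)
  then have "set ?i \<subseteq> {1..N}" using assms(2) by auto
  moreover have "length ?i = length \<alpha>" by (simp only: length_upt diff_Suc_1)
  ultimately show ?thesis
    using spread_in_words[OF assms(1), of ?i N] sorted_wrt_upt by blast
qed

text \<open>For each composition one word with its rise set is fixed. The monomial of this word
  occurs in the \<open>M\<close> of that composition with coefficient 1 and in no other, so the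
  coefficients at these monomials form a system dual to the \<open>M\<close>.\<close>

lemma M_independent:
  assumes "n \<le> N"
  shows "inj_on (M N :: nat list \<Rightarrow> 'a::field mpoly) (compositions n)"
    and "mpoly.independent ((M N :: nat list \<Rightarrow> 'a::field mpoly) ` compositions n)"
proof -
  let ?M = "M N :: nat list \<Rightarrow> 'a mpoly"
  have "\<exists>w. w \<in> words N n \<and> rises w = sub \<alpha>" if "\<alpha> \<in> compositions n" for \<alpha>
    using word_with_rises_exists[OF that assms] by blast
  then obtain w where w: "w \<alpha> \<in> words N n" "rises (w \<alpha>) = sub \<alpha>" if "\<alpha> \<in> compositions n" for \<alpha>
    by metis
  have lookup: "Poly_Mapping.lookup (?M \<alpha>) (word_exponent (w \<beta>)) = (if \<alpha> = \<beta> then 1 else 0)"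
    if "\<alpha> \<in> compositions n" "\<beta> \<in> compositions n" for \<alpha> \<beta>
    using inj_on_eq_iff[OF inj_on_sub that]
    by (auto simp: lookup_M[OF that(1) w(1)[OF that(2)]] w(2)[OF that(2)])
  show inj: "inj_on ?M (compositions n)"
    using lookup by (intro inj_onI) (metis zero_neq_one)
  have "u (?M \<beta>) = 0" if \<beta>: "\<beta> \<in> compositions n"
    and 0: "(\<Sum>v\<in>?M ` compositions n. cmul (u v) v) = 0" for u \<beta>
  proof -
    have cmul: "Poly_Mapping.lookup (cmul c p) e = c * Poly_Mapping.lookup p e"
      for c e and p :: "'a mpoly"
      unfolding cmul_def mult_map_scale_conv_mult[symmetric] by (simp add: map.rep_eq when_def)
    have "0 = Poly_Mapping.lookup (\<Sum>\<alpha>\<in>compositions n. cmul (u (?M \<alpha>)) (?M \<alpha>)) (word_exponent (w \<beta>))"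
      using 0 by (simp add: sum.reindex[OF inj])
    also have "\<dots> = (\<Sum>\<alpha>\<in>compositions n. if \<alpha> = \<beta> then u (?M \<beta>) else 0)"
      unfolding lookup_sum cmul using \<beta> by (intro sum.cong refl) (auto simp: lookup)
    finally show ?thesis using \<beta> by simp
  qed
  then show "mpoly.independent (?M ` compositions n)"
    by (subst mpoly.dependent_finite) auto
qed

text \<open>The monomial quasisymmetric polynomials are independent, equinumerous with the \<open>G\<close> and
  contained in their span.\<close>

lemma G_independent:
  fixes t :: "'a::field"
  assumes "n \<le> N"
  shows "inj_on (G N t) (compositions n)" and "mpoly.independent (G N t ` compositions n)"
proof -
  let ?M = "(M N :: nat list \<Rightarrow> 'a mpoly) ` compositions n" and ?G = "G N t ` compositions n"
  have card_M: "card ?M = card (compositions n)"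
    using M_independent(1)[OF assms] by (rule card_image)
  have M_span: "?M \<subseteq> mpoly.span ?G"
  proof
    fix v assume "v \<in> ?M"
    then obtain \<alpha> where \<alpha>: "\<alpha> \<in> compositions n" "v = M N \<alpha>" by blast
    show "v \<in> mpoly.span ?G"
      unfolding \<alpha>(2) M_eq_sum_G[OF \<alpha>(1), of N t]
      by (intro mpoly.span_sum mpoly.span_scale mpoly.span_base) auto
  qed
  \<comment> \<open>Stated for an arbitrary T because it is applied twice: to all the
    \<open>G\<close>, which forces them to be pairwise distinct, and to the \<open>G\<close> without
    a redundant vector, where the count is impossible.\<close>
  have bound: "card (compositions n) \<le> card T" if "finite T" "?M \<subseteq> mpoly.span T" for T
    using mpoly.independent_span_bound[OF that(1) M_independent(2)[OF assms] that(2)] card_M by simp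
  have card_G: "card ?G = card (compositions n)"
    using bound[OF _ M_span] card_image_le[of "compositions n" "G N t"] by simp
  then show "inj_on (G N t) (compositions n)" by (simp add: eq_card_imp_inj_on)
  show "mpoly.independent ?G"
  proof
    assume "mpoly.dependent ?G"
    then obtain v where v: "v \<in> ?G" "v \<in> mpoly.span (?G - {v})"
      by (auto simp: mpoly.dependent_def)
    then have "mpoly.span (?G - {v}) = mpoly.span ?G"
      by (metis insert_Diff mpoly.span_redundant)
    then have "card (compositions n) \<le> card (?G - {v})" using bound M_span by simp
    moreover have "card (?G - {v}) < card ?G" using v by (intro card_Diff1_less) auto
    ultimately show False using card_G by simp
  qed
qed

theorem theorem5p2:
  fixes n N :: nat and \<alpha> \<beta> :: "nat list"
  assumes "\<alpha> \<in> compositions n" and "\<beta> \<in> compositions n" and "n \<le> N"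
  shows "G_coeff n N (M N \<alpha>) \<beta> =
    (if refines \<beta> \<alpha>
     then (- 1) ^ (length \<beta> - length \<alpha>) *
          (\<Prod>j\<in>{j \<in> {1..<length \<beta>}. xi \<alpha> \<beta> j = j}. 1 - tt ^ j)
     else 0)"
proof -
  let ?G = "G N tt ` compositions n" and ?R = "{\<gamma> \<in> compositions n. refines \<gamma> \<alpha>}"
  note ind = G_independent(2)[OF assms(3), of tt] and inj = G_independent(1)[OF assms(3), of tt]
  have span: "G N tt \<gamma> \<in> mpoly.span ?G" if "\<gamma> \<in> ?R" for \<gamma>
    using that by (auto intro: mpoly.span_base)
  have "G_coeff n N (M N \<alpha>) \<beta>
      = (\<Sum>\<gamma>\<in>?R. MG_coeff tt \<alpha> \<gamma> * mpoly.representation ?G (G N tt \<gamma>) (G N tt \<beta>))"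
    unfolding G_coeff_def M_eq_sum_G[OF assms(1), of N tt]
    by (subst mpoly.representation_sum[OF ind])
      (auto simp: mpoly.representation_scale[OF ind] span intro: mpoly.span_scale)
  \<comment> \<open>\<open>representation\<close> compares vectors; injectivity turns equality of
    \<open>G N tt \<gamma>\<close> and \<open>G N tt \<beta>\<close> into
    \<open>\<gamma> = \<beta>\<close>.\<close>
  also have "\<dots> = (\<Sum>\<gamma>\<in>?R. if \<gamma> = \<beta> then MG_coeff tt \<alpha> \<beta> else 0)"
    using inj assms(2)
    by (intro sum.cong refl) (auto simp: mpoly.representation_basis[OF ind] dest: inj_onD)
  also have "\<dots> = (if refines \<beta> \<alpha> then MG_coeff tt \<alpha> \<beta> else 0)"
    using assms(2) by simp
  finally show ?thesis by (simp add: MG_coeff_def)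
qed

end
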